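(* There exists a sequence $f_{1,\infty}=(f_1,f_2,\dots)$ of surjective continuous maps from $I=[0,1]$ to itself such that (1) $f_{1,\infty}$ converges uniformly on $I$ to some continuous map $f\colon I\to I$; (2) there is a strictly increasing sequence $S$ of positive integers with $h_S(f_{1,\infty})\ge \log 3$; (3) the nonautonomous system $(I,f_{1,\infty})$ is not Li–Yorke chaotic.
   Context: A nonautonomous dynamical system (NDS) $(X,f_{1,\infty})$ consists of a compact metric space $(X,\varrho)$ and a sequence $f_{1,\infty}=(f_n)_{n\ge1}$ of continuous maps $X\to X$. Iterates: $f_1^0(x)=x$ and $f_1^n(x)=f_n(f_1^{n-1}(x))$, i.e. $f_1^n=f_n\circ\dots\circ f_1$. Li–Yorke pair: distinct $x,y\in X$ with $\limsup_{n\to\infty}\varrho(f_1^n(x),f_1^n(y))>0$ and $\liminf_{n\to\infty}\varrho(f_1^n(x),f_1^n(y))=0$. A set is Li–Yorke scrambled if any two distinct points of it form a Li–Yorke pair; the NDS is Li–Yorke chaotic if $X$ contains an uncountable Li–Yorke scrambled set. Topological sequence entropy: for a strictly increasing sequence $A=(a_i)_{i\ge1}$ of positive integers and $n\ge1$ put $\varrho_n^A(x,y)=\max_{1\le j\le n}\varrho(f_1^{a_j}(x),f_1^{a_j}(y))$. A set $E\subseteq X$ is $(n,\varepsilon,A)$-separated if $\varrho_n^A(x,y)>\varepsilon$ for all distinct $x,y\in E$; let $s_n^A(f_{1,\infty},\varepsilon)$ be the maximal cardinality of such a set. Then $h_A(f_{1,\infty})=\lim_{\varepsilon\to0}\limsup_{n\to\infty}\frac1n\log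 s_n^A(f_{1,\infty},\varepsilon)$. *)

theory Defs
  imports "HOL-Analysis.Analysis" "HOL-Library.Liminf_Limsup"
begin

text \<open>Nonautonomous dynamical system given by a sequence f with f n = f_n for n \<ge> 1
  (the value f 0 is never used). nds_iter f n = f_n o ... o f_1.\<close>
primrec nds_iter :: "(nat \<Rightarrow> 'a \<Rightarrow> 'a) \<Rightarrow> nat \<Rightarrow> 'a \<Rightarrow> 'a" where
  "nds_iter f 0 = id"
| "nds_iter f (Suc n) = f (Suc n) \<circ> nds_iter f n"

definition LY_pair :: "(nat \<Rightarrow> 'a::metric_space \<Rightarrow> 'a) \<Rightarrow> 'a \<Rightarrow> 'a \<Rightarrow> bool" where
  "LY_pair f x y \<longleftrightarrow> x \<noteq> y
     \<and> limsup (\<lambda>n. ereal (dist (nds_iter f n x) (nds_iter f n y))) > 0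
     \<and> liminf (\<lambda>n. ereal (dist (nds_iter f n x) (nds_iter f n y))) = 0"

definition LY_scrambled :: "(nat \<Rightarrow> 'a::metric_space \<Rightarrow> 'a) \<Rightarrow> 'a set \<Rightarrow> bool" where
  "LY_scrambled f S \<longleftrightarrow> (\<forall>x\<in>S. \<forall>y\<in>S. x \<noteq> y \<longrightarrow> LY_pair f x y)"

definition LY_chaotic :: "'a::metric_space set \<Rightarrow> (nat \<Rightarrow> 'a \<Rightarrow> 'a) \<Rightarrow> bool" where
  "LY_chaotic X f \<longleftrightarrow> (\<exists>S. S \<subseteq> X \<and> uncountable S \<and> LY_scrambled f S)"

text \<open>Sequences A = (a_1, a_2, ...) are represented 0-based: a_j = A (j - 1).
  seq_dist f A n x y = max_{1 \<le> j \<le> n} dist (f_1^{a_j} x) (f_1^{a_j} y).\<close>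
definition seq_dist :: "(nat \<Rightarrow> 'a::metric_space \<Rightarrow> 'a) \<Rightarrow> (nat \<Rightarrow> nat) \<Rightarrow> nat \<Rightarrow> 'a \<Rightarrow> 'a \<Rightarrow> real" where
  "seq_dist f A n x y = Max ((\<lambda>j. dist (nds_iter f (A j) x) (nds_iter f (A j) y)) ` {..<n})"

definition separated :: "(nat \<Rightarrow> 'a::metric_space \<Rightarrow> 'a) \<Rightarrow> (nat \<Rightarrow> nat) \<Rightarrow> nat \<Rightarrow> real \<Rightarrow> 'a set \<Rightarrow> bool" where
  "separated f A n \<epsilon> E \<longleftrightarrow> (\<forall>x\<in>E. \<forall>y\<in>E. x \<noteq> y \<longrightarrow> seq_dist f A n x y > \<epsilon>)"

text \<open>Maximal cardinality of an (n,eps,A)-separated subset of X (finite for compact X).\<close>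
definition sep_num :: "'a::metric_space set \<Rightarrow> (nat \<Rightarrow> 'a \<Rightarrow> 'a) \<Rightarrow> (nat \<Rightarrow> nat) \<Rightarrow> nat \<Rightarrow> real \<Rightarrow> nat" where
  "sep_num X f A n \<epsilon> = Sup {card E | E. finite E \<and> E \<subseteq> X \<and> separated f A n \<epsilon> E}"

definition seq_entropy :: "'a::metric_space set \<Rightarrow> (nat \<Rightarrow> 'a \<Rightarrow> 'a) \<Rightarrow> (nat \<Rightarrow> nat) \<Rightarrow> ereal" where
  "seq_entropy X f A = Lim (at_right 0)
     (\<lambda>\<epsilon>. limsup (\<lambda>n. ereal (ln (real (sep_num X f A n \<epsilon>)) / real n)))"

end

theory Submission
  imports Defs
begin

text \<open>All maps fix 0 and 1, and the limit is the identity. Any finite composition of maps close to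
  the identity may be inserted into the sequence, and this already allows two kinds of large moves:
  a full-size zigzag on \<open>[0, 1/2]\<close> (contract towards 0, fold at small scale, expand again) and
  a collapse of \<open>[0, s]\<close> to the point 0 for any \<open>s < 1\<close>. Number these moves 1, 2, 3, \<open>\<dots>\<close>,
  let those with number \<open>2^k\<close> be collapses and all others zigzags. The zigzags have nine separated
  full laps, so the run between \<open>2^k\<close> and \<open>2^(k+1)\<close> separates \<open>9^(2^k) = 3^(2^(k+1))\<close> points, which
  gives sequence entropy at least \<open>ln 3\<close> along the times at which moves end. Choosing each collapse
  strong enough to outweigh all earlier moves, every point other than 1 eventually lands on 0
  and stays there, so there is not even a single Li--Yorke pair.\<close>

section \<open>Maps close to the identity\<close>

text \<open>Fixing both endpoints survives composition and forces surjectivity by the intermediate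
  value theorem. The fixed point 0 makes absorption permanent, and 1 is the one point never
  absorbed.\<close>

definition unit_map :: "(real \<Rightarrow> real) \<Rightarrow> bool" where
  "unit_map h \<longleftrightarrow> continuous_on {0..1} h \<and> h ` {0..1} \<subseteq> {0..1} \<and> h 0 = 0 \<and> h 1 = 1"

definition near_id :: "real \<Rightarrow> (real \<Rightarrow> real) \<Rightarrow> bool" where
  "near_id r h \<longleftrightarrow> unit_map h \<and> (\<forall>x\<in>{0..1}. \<bar>h x - x\<bar> \<le> r)"

text \<open>The list is in order of time: its head is applied first. A nonempty list means that a
  move takes at least one time step, so the end times of successive moves increase strictly.\<close>

definition factorable :: "real \<Rightarrow> (real \<Rightarrow> real) \<Rightarrow> bool" where
  "factorable r h \<longleftrightarrow> (\<exists>hs. hs \<noteq> [] \<and> (\<forall>g\<in>set hs. near_id r g) \<and> h = fold (\<circ>) hs id)"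

lemma unit_map_id: "unit_map id"
  by (auto simp: unit_map_def)

lemma unit_map_comp:
  assumes "unit_map g" "unit_map h"
  shows "unit_map (g \<circ> h)"
proof -
  have "continuous_on {0..1} (g \<circ> h)"
    using assms unfolding unit_map_def by (meson continuous_on_compose continuous_on_subset)
  then show ?thesis using assms by (auto simp: unit_map_def image_subset_iff)
qed

lemma unit_map_mem:
  assumes "unit_map h" "x \<in> {0..1}"
  shows "0 \<le> h x" "h x \<le> 1"
  using assms by (auto simp: unit_map_def image_subset_iff)

lemma unit_map_surj:
  assumes "unit_map h"
  shows "h ` {0..1} = {0..1}"
proof
  show "{0..1} \<subseteq> h ` {0..1}"
  proof
    fix y :: real assume "y \<in> {0..1}"
    then have "\<exists>x\<ge>0. x \<le> 1 \<and> h x = y"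
      using assms by (intro IVT') (auto simp: unit_map_def)
    then show "y \<in> h ` {0..1}" by force
  qed
qed (use assms in \<open>auto simp: unit_map_def\<close>)

lemma unit_map_nds_iter:
  assumes "\<And>n. unit_map (f (Suc n))"
  shows "unit_map (nds_iter f n)"
proof (induction n)
  case (Suc n)
  show ?case unfolding nds_iter.simps by (rule unit_map_comp[OF assms Suc])
qed (simp only: nds_iter.simps unit_map_id)

section \<open>Concatenating finite compositions in time\<close>

lemma fold_comp_append:
  "fold (\<circ>) (xs @ ys) id = fold (\<circ>) ys id \<circ> fold (\<circ>) xs id"
proof -
  \<comment> \<open>The accumulator \<open>h\<close> is kept general so that the induction goes
    through.\<close>
  have "fold (\<circ>) ys h x = fold (\<circ>) ys id (h x)" for h :: "'a \<Rightarrow> 'a" and x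
  proof (induction ys arbitrary: h x)
    case (Cons y ys)
    have "fold (\<circ>) (y # ys) h x = fold (\<circ>) ys id ((y \<circ> h) x)"
      unfolding fold_simps by (rule Cons)
    also have "\<dots> = fold (\<circ>) ys id (y (h x))" by (simp only: comp_apply)
    also have "\<dots> = fold (\<circ>) (y # ys) id (h x)"
      unfolding fold_simps comp_id by (rule Cons[symmetric])
    finally show ?case .
  qed simp
  then show ?thesis unfolding fold_append comp_apply by (intro ext) (metis comp_apply)
qed

lemma near_id_mono: "near_id r h \<Longrightarrow> r \<le> s \<Longrightarrow> near_id s h"
  by (force simp: near_id_def)

lemma factorable_near_id: "near_id r h \<Longrightarrow> factorable r h"
  unfolding factorable_def by (intro exI[of _ "[h]"]) simp

lemma factorable_comp:
  assumes "factorable r g" "factorable r h"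
  shows "factorable r (g \<circ> h)"
proof -
  from assms obtain xs ys where "xs \<noteq> []" "\<forall>g\<in>set xs. near_id r g" "g = fold (\<circ>) xs id"
    "ys \<noteq> []" "\<forall>g\<in>set ys. near_id r g" "h = fold (\<circ>) ys id"
    unfolding factorable_def by blast
  then show ?thesis
    unfolding factorable_def by (intro exI[of _ "ys @ xs"]) (use fold_comp_append[of ys xs] in auto)
qed

lemma factorable_funpow:
  assumes "near_id r h"
  shows "factorable r (h ^^ Suc n)"
proof (induction n)
  case 0
  show ?case using factorable_near_id[OF assms] by simp
next
  case (Suc n)
  show ?case
    unfolding funpow.simps(2)[of "Suc n"]
    by (rule factorable_comp[OF factorable_near_id[OF assms] Suc])
qed

lemma unit_map_factorable:
  assumes "factorable r h"
  shows "unit_map h"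
proof -
  have "unit_map (fold (\<circ>) hs g)" if "\<forall>k\<in>set hs. near_id r k" "unit_map g" for hs g
    using that
    by (induction hs arbitrary: g) (auto simp: near_id_def intro!: unit_map_comp)
  then show ?thesis using assms unit_map_id unfolding factorable_def by blast
qed

text \<open>Writing the factors of all moves one after another gives \<open>f\<close>. The factors
  of the n-th list are \<open>e n\<close>-close to the identity, hence uniform convergence; at the
  ends of lists the iterates of \<open>f\<close> and \<open>G\<close> agree.\<close>

lemma flatten_factorable:
  fixes G :: "nat \<Rightarrow> real \<Rightarrow> real" and e :: "nat \<Rightarrow> real"
  assumes "\<And>n. factorable (e n) (G (Suc n))" "e \<longlonglongrightarrow> 0"
  obtains f S where "\<And>n. unit_map (f (Suc n))"
    "uniform_limit {0..1} (\<lambda>n. f (Suc n)) (\<lambda>x. x) sequentially"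
    "strict_mono S" "0 < S 0" "\<And>n. nds_iter f (S n) = nds_iter G (Suc n)"
proof -
  obtain hs where hs: "\<And>n. hs n \<noteq> []" "\<And>n g. g \<in> set (hs n) \<Longrightarrow> near_id (e n) g"
    "\<And>n. G (Suc n) = fold (\<circ>) (hs n) id"
    using assms(1) unfolding factorable_def by metis
  \<comment> \<open>\<open>T n\<close> is the total length of the first \<open>n\<close> lists, and
    \<open>b i\<close> is the list containing position \<open>i\<close>, counted from 0. Time in
    \<open>f\<close> starts at 1, hence the \<open>i - 1\<close>.\<close>
  define T where "T n = (\<Sum>i<n. length (hs i))" for n
  define b where "b i = (LEAST n. i < T (Suc n))" for i
  define f where "f i = hs (b (i - 1)) ! (i - 1 - T (b (i - 1)))" for i
  have T0: "T 0 = 0" and TS: "T (Suc n) = T n + length (hs n)" for n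
    by (simp_all add: T_def)
  have mono: "strict_mono T"
    using hs(1) by (simp add: strict_mono_Suc_iff TS)
  have b: "b (T n + j) = n" if "j < length (hs n)" for n j
    unfolding b_def
  proof (rule Least_equality)
    fix m assume m: "T n + j < T (Suc m)"
    show "n \<le> m"
    proof (rule ccontr)
      assume "\<not> n \<le> m"
      then have "T (Suc m) \<le> T n"
        using mono by (simp add: strict_mono_less_eq)
      with m show False by simp
    qed
  qed (use that TS in simp)
  have f: "f (Suc (T n + j)) = hs n ! j" if "j < length (hs n)" for n j
    using b[OF that] by (simp add: f_def)
  have decomp: "\<exists>n j. i = T n + j \<and> j < length (hs n)" for i
  proof (induction i)
    case 0
    show ?case using hs(1)[of 0] T0 by (intro exI[of _ 0]) auto
  next
    case (Suc i)
    then obtain n j where nj: "i = T n + j" "j < length (hs n)" by blast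
    show ?case
    proof (cases "Suc j < length (hs n)")
      case True
      with nj show ?thesis by (intro exI[of _ n] exI[of _ "Suc j"]) auto
    next
      case False
      with nj hs(1)[of "Suc n"] show ?thesis
        by (intro exI[of _ "Suc n"] exI[of _ 0]) (auto simp: TS)
    qed
  qed
  have iter_take: "nds_iter f (T n + j) = fold (\<circ>) (take j (hs n)) id \<circ> nds_iter f (T n)"
    if "j \<le> length (hs n)" for n j
    using that
  proof (induction j)
    case (Suc j)
    then show ?case
      by (simp add: f take_Suc_conv_app_nth fold_comp_append comp_assoc)
  qed simp
  have iter: "nds_iter f (T n) = nds_iter G n" for n
    by (induction n) (simp_all add: T0 TS iter_take hs(3))
  have near: "near_id (e n) (f (Suc (T n + j)))" if "j < length (hs n)" for n j
    using that by (simp add: f hs(2))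
  show ?thesis
  \<comment> \<open>The shift by one drops \<open>T 0 = 0\<close>, since the times must be
    positive.\<close>
  proof (rule that[of f "\<lambda>n. T (Suc n)"])
    show "unit_map (f (Suc i))" for i
      using decomp[of i] near unfolding near_id_def by blast
    show "uniform_limit {0..1} (\<lambda>n. f (Suc n)) (\<lambda>x. x) sequentially"
      unfolding uniform_limit_sequentially_iff
    proof (intro allI impI)
      fix r :: real assume "r > 0"
      then obtain n0 where n0: "\<And>n. n \<ge> n0 \<Longrightarrow> \<bar>e n\<bar> < r"
        using LIMSEQ_D[OF assms(2), of r] by auto
      have "dist (f (Suc i) x) x < r" if "i \<ge> T n0" "x \<in> {0..1}" for i x
      proof -
        obtain n j where nj: "i = T n + j" "j < length (hs n)" using decomp by blast
        \<comment> \<open>Positions from \<open>T n0\<close> on lie only in lists of index at least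
          \<open>n0\<close>, whose factors are closer than \<open>r\<close> to the identity.\<close>
        have "n0 \<le> n"
        proof (rule ccontr)
          assume "\<not> n0 \<le> n"
          then have "T (Suc n) \<le> T n0"
            using mono by (simp add: strict_mono_less_eq)
          with that nj TS show False by simp
        qed
        with n0[of n] near[OF nj(2)] that(2) nj(1) show ?thesis
          by (force simp: near_id_def dist_real_def)
      qed
      then show "\<exists>N. \<forall>n\<ge>N. \<forall>x\<in>{0..1}. dist (f (Suc n) x) x < r" by blast
    qed
    show "strict_mono (\<lambda>n. T (Suc n))"
      using mono by (simp add: strict_mono_def)
    show "0 < T (Suc 0)" using hs(1) by (simp add: TS)
    show "nds_iter f (T (Suc n)) = nds_iter G (Suc n)" for n by (rule iter)
  qed
qed

section \<open>The zigzag and its itineraries\<close>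

text \<open>The map has 17 laps; every second one is used, which leaves nine laps at mutual distance at
  least 1/17.\<close>

definition zigzag :: "real \<Rightarrow> real" where
  "zigzag u = (1 - cos (17 * pi * u)) / 2"

lemma zigzag_mem: "0 \<le> zigzag u" "zigzag u \<le> 1"
  by (auto simp: zigzag_def intro: order_trans[OF cos_ge_minus_one])

lemma zigzag_lap_ends:
  "zigzag (2 * real a / 17) = 0" "zigzag ((2 * real a + 1) / 17) = 1"
proof -
  have "cos (pi * (2 * real a)) = 1"
    using cos_2npi[of a] by (simp add: mult_ac)
  moreover have "cos (pi * (2 * real a + 1)) = -1"
    using cos_npi[of "2 * a + 1"] by (simp add: algebra_simps)
  moreover have "17 * pi * (t / 17) = pi * t" for t by simp
  ultimately show "zigzag (2 * real a / 17) = 0" "zigzag ((2 * real a + 1) / 17) = 1"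
    unfolding zigzag_def by (simp_all only:) simp_all
qed

text \<open>As 17 = 2 * 8 + 1 is odd, the last lap ascends and ends at 1.\<close>

lemma zigzag_0_1: "zigzag 0 = 0" "zigzag 1 = 1"
  using zigzag_lap_ends(1)[of 0] zigzag_lap_ends(2)[of 8] by simp_all

lemma continuous_on_zigzag: "continuous_on A zigzag"
  unfolding zigzag_def by (intro continuous_intros) auto

lemma zigzag_lap_surj:
  assumes "v \<in> {0..1}"
  obtains u where "u \<in> {2 * real a / 17..(2 * real a + 1) / 17}" "zigzag u = v"
proof -
  have "\<exists>u\<ge>2 * real a / 17. u \<le> (2 * real a + 1) / 17 \<and> zigzag u = v"
    using assms by (intro IVT') (auto simp: zigzag_lap_ends continuous_on_zigzag divide_right_mono)
  then show ?thesis using that by auto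
qed

text \<open>Each used lap is mapped onto the whole of [0,1], so a point realising the tail of the
  word has a preimage in the lap named by the first letter.\<close>

lemma zigzag_itinerary:
  assumes "set w \<subseteq> {..<9}"
  shows "\<exists>u\<in>{0..1}. \<forall>j<length w.
    (zigzag ^^ j) u \<in> {2 * real (w ! j) / 17..(2 * real (w ! j) + 1) / 17}"
  using assms
proof (induction w)
  case Nil
  show ?case by (intro bexI[of _ 0]) auto
next
  case (Cons a w)
  then obtain v where v: "v \<in> {0..1}" "\<forall>j<length w.
    (zigzag ^^ j) v \<in> {2 * real (w ! j) / 17..(2 * real (w ! j) + 1) / 17}" by auto
  obtain u where u: "u \<in> {2 * real a / 17..(2 * real a + 1) / 17}" "zigzag u = v"
    using zigzag_lap_surj[OF v(1)] by blast
  have "real a \<le> 8" using Cons.prems by simp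
  then have "(2 * real a + 1) / 17 \<le> 1" by simp
  moreover have "0 \<le> 2 * real a / 17" by simp
  ultimately have "u \<in> {0..1}"
    using u(1) unfolding atLeastAtMost_iff by linarith
  moreover have "(zigzag ^^ j) u \<in> {2 * real ((a # w) ! j) / 17..(2 * real ((a # w) ! j) + 1) / 17}"
    if "j < length (a # w)" for j
  proof (cases j)
    case (Suc i)
    then have "(zigzag ^^ j) u = (zigzag ^^ i) v"
      by (simp add: funpow_Suc_right u(2) del: funpow.simps)
    with v(2) that Suc show ?thesis by simp
  qed (use u in simp)
  ultimately show ?case by blast
qed

section \<open>Building blocks\<close>

text \<open>Contraction towards 0, exactly linear on [0, 1/2]; the second branch returns to the
  fixed point 1.\<close>

definition pull :: "real \<Rightarrow> real \<Rightarrow> real" where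
  "pull m u = max (m * u) (2 * u - 1)"

text \<open>Dilation from 0, exactly linear while the result is at most 1/2, because the second
  branch is at least 1/2 for \<open>u \<ge> 0\<close>; that branch fixes 1.\<close>

definition push :: "real \<Rightarrow> real \<Rightarrow> real" where
  "push l u = min (l * u) ((1 + u) / 2)"

text \<open>The zigzag rescaled to [0, d], continued by the identity: beyond \<open>d\<close> the
  first summand stays at \<open>d * zigzag 1 = d\<close>.\<close>

definition small_zigzag :: "real \<Rightarrow> real \<Rightarrow> real" where
  "small_zigzag d u = d * zigzag (min u d / d) + max 0 (u - d)"

text \<open>Dilation from the fixed point 1, cut off at 0.\<close>

definition collapse :: "real \<Rightarrow> real \<Rightarrow> real" where
  "collapse l u = max 0 (1 - l * (1 - u))"

lemma near_id_pull:
  assumes "0 < m" "m \<le> 1"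
  shows "near_id (1 - m) (pull m)"
proof -
  have 1: "m * u \<le> u" "u - m * u \<le> 1 - m" "0 \<le> m * u" if "u \<in> {0..1}" for u
  proof -
    show "m * u \<le> u" "0 \<le> m * u" using assms that by (auto simp: mult_left_le_one_le)
    have "(1 - m) * u \<le> 1 - m" using assms that by (intro mult_left_le) auto
    then show "u - m * u \<le> 1 - m" by (simp add: algebra_simps)
  qed
  have "continuous_on {0..1} (pull m)"
    unfolding pull_def by (intro continuous_intros)
  moreover have "pull m u \<in> {0..1}" "\<bar>pull m u - u\<bar> \<le> 1 - m" if "u \<in> {0..1}" for u
    using 1[OF that] that by (auto simp: pull_def max_def)
  ultimately show ?thesis
    using assms by (auto simp: near_id_def unit_map_def pull_def)
qed

lemma near_id_push:
  assumes "1 \<le> l"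
  shows "near_id (l - 1) (push l)"
proof -
  have 1: "u \<le> l * u" "l * u - u \<le> l - 1" if "u \<in> {0..1}" for u
  proof -
    show "u \<le> l * u" using assms that mult_right_mono[of 1 l u] by auto
    have "(l - 1) * u \<le> l - 1" using assms that by (intro mult_left_le) auto
    then show "l * u - u \<le> l - 1" by (simp add: algebra_simps)
  qed
  have "continuous_on {0..1} (push l)"
    unfolding push_def by (intro continuous_intros) auto
  moreover have "push l u \<in> {0..1}" "\<bar>push l u - u\<bar> \<le> l - 1" if "u \<in> {0..1}" for u
    using 1[OF that] that by (auto simp: push_def min_def)
  ultimately show ?thesis
    using assms by (auto simp: near_id_def unit_map_def push_def)
qed

lemma near_id_collapse:
  assumes "1 \<le> l"
  shows "near_id (l - 1) (collapse l)"
proof -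
  have 1: "1 - u \<le> l * (1 - u)" "l * (1 - u) - (1 - u) \<le> l - 1" if "u \<in> {0..1}" for u
  proof -
    show "1 - u \<le> l * (1 - u)" using assms that mult_right_mono[of 1 l "1 - u"] by auto
    have "(l - 1) * (1 - u) \<le> l - 1" using assms that by (intro mult_left_le) auto
    then show "l * (1 - u) - (1 - u) \<le> l - 1" by (simp add: algebra_simps)
  qed
  have "continuous_on {0..1} (collapse l)"
    unfolding collapse_def by (intro continuous_intros)
  moreover have "collapse l u \<in> {0..1}" "\<bar>collapse l u - u\<bar> \<le> l - 1" if "u \<in> {0..1}" for u
    using 1[OF that] that by (auto simp: collapse_def max_def)
  ultimately show ?thesis
    using assms by (auto simp: near_id_def unit_map_def collapse_def)
qed

lemma small_zigzag_simps:
  assumes "0 < d"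
  shows "u \<le> d \<Longrightarrow> small_zigzag d u = d * zigzag (u / d)"
    and "d \<le> u \<Longrightarrow> small_zigzag d u = u"
  using assms by (auto simp: small_zigzag_def zigzag_0_1)

lemma near_id_small_zigzag:
  assumes "0 < d" "d \<le> 1"
  shows "near_id d (small_zigzag d)"
proof -
  have "continuous_on {0..1} (small_zigzag d)"
    unfolding small_zigzag_def
    by (intro continuous_intros continuous_on_compose2[OF continuous_on_zigzag[of UNIV]])
      (use assms in auto)
  moreover have "small_zigzag d u \<in> {0..1} \<and> \<bar>small_zigzag d u - u\<bar> \<le> d" if "u \<in> {0..1}" for u
  proof (cases "u \<le> d")
    case True
    have "d * zigzag (u / d) \<le> d" "0 \<le> d * zigzag (u / d)"
      using assms zigzag_mem by (simp_all add: mult_left_le)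
    then show ?thesis
      unfolding small_zigzag_simps(1)[OF assms(1) True]
      using True that assms(2) unfolding atLeastAtMost_iff by linarith
  qed (use that assms in \<open>auto simp: small_zigzag_simps\<close>)
  ultimately show ?thesis
    using assms by (auto simp: near_id_def unit_map_def small_zigzag_simps zigzag_0_1)
qed

section \<open>Iterates of the building blocks and their distance to the fixed point 1\<close>

lemma funpow_pull:
  assumes "0 < m" "m \<le> 1" "0 \<le> u" "u \<le> 1 / 2"
  shows "(pull m ^^ N) u = m ^ N * u"
proof (induction N)
  case (Suc N)
  have "m ^ N * u \<le> 1 / 2"
    using assms mult_mono[of "m ^ N" 1 u "1/2"] by (simp add: power_le_one)
  moreover have "0 \<le> m * (m ^ N * u)" using assms by simp
  ultimately show ?case using Suc by (simp add: pull_def max_def mult_ac)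
qed simp

text \<open>Since \<open>l \<ge> 1\<close>, the bound on the last value bounds all earlier ones, so
  the orbit never leaves the linear branch.\<close>

lemma funpow_push:
  assumes "1 \<le> l" "0 \<le> v" "l ^ N * v \<le> 1 / 2"
  shows "(push l ^^ N) v = l ^ N * v"
  using assms(3)
proof (induction N)
  case (Suc N)
  have "1 * (l ^ N * v) \<le> l * (l ^ N * v)"
    using assms by (intro mult_right_mono) auto
  then have "l ^ N * v \<le> 1 / 2" using Suc.prems by (simp add: mult_ac)
  with Suc have "(push l ^^ Suc N) v = push l (l ^ N * v)" by simp
  moreover have "0 \<le> l ^ N * v" using assms by simp
  moreover have "l * (l ^ N * v) \<le> 1 / 2" using Suc.prems by (simp add: mult_ac)
  moreover have "push l x = l * x" if "0 \<le> x" "l * x \<le> 1 / 2" for x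
    using that by (simp add: push_def)
  ultimately have "(push l ^^ Suc N) v = l * (l ^ N * v)" by simp
  then show ?case by (simp add: mult_ac)
qed simp

text \<open>The gap \<open>1 - u\<close> is the quantity tracked throughout: zigzags may shrink it
  by a controlled factor only, and a later collapse makes up for the loss.\<close>

lemma funpow_gap:
  fixes h :: "real \<Rightarrow> real"
  assumes "\<And>u. u \<in> {0..1} \<Longrightarrow> h u \<in> {0..1}" "0 \<le> c"
    "\<And>u. u \<in> {0..1} \<Longrightarrow> c * (1 - u) \<le> 1 - h u" "u \<in> {0..1}"
  shows "(h ^^ N) u \<in> {0..1} \<and> c ^ N * (1 - u) \<le> 1 - (h ^^ N) u"
proof (induction N)
  case (Suc N)
  have "c * (c ^ N * (1 - u)) \<le> c * (1 - (h ^^ N) u)"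
    using Suc assms(2) by (blast intro: mult_left_mono)
  also have "\<dots> \<le> 1 - h ((h ^^ N) u)" using Suc assms(3) by blast
  finally show ?case using Suc assms(1) by (simp add: mult_ac)
qed (use assms in simp)

lemma pull_gap:
  assumes "0 < m" "m \<le> 1" "u \<in> {0..1}"
  shows "1 - u \<le> 1 - pull m u"
  using assms by (auto simp: pull_def mult_left_le_one_le)

lemma push_gap: "1 / 2 * (1 - u) \<le> 1 - push l u"
  by (auto simp: push_def min_def field_simps)

lemma small_zigzag_gap:
  assumes "0 < d" "d \<le> 1 / 2" "u \<in> {0..1}"
  shows "1 / 2 * (1 - u) \<le> 1 - small_zigzag d u"
proof (cases "u \<le> d")
  case True
  have "d * zigzag (u / d) \<le> d"
    using assms zigzag_mem by (auto intro: mult_left_le)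
  then show ?thesis
    unfolding small_zigzag_simps(1)[OF assms(1) True]
    using assms(2,3) unfolding atLeastAtMost_iff by argo
qed (use assms in \<open>auto simp: small_zigzag_simps\<close>)

text \<open>Squeezing \<open>[0, 1/2]\<close> into \<open>[0, d]\<close> makes a zigzag of amplitude \<open>d\<close> suffice: after expanding
  back, \<open>[0, 1/2]\<close> carries a full-size zigzag which does not depend on \<open>r\<close>.\<close>

lemma zigzag_block:
  assumes "0 < r"
  shows "\<exists>Z c. factorable r Z \<and> (\<forall>u\<in>{0..1/2}. Z u = zigzag (2 * u) / 2) \<and> 0 < c \<and> c \<le> 1
    \<and> (\<forall>u\<in>{0..1}. c * (1 - u) \<le> 1 - Z u)"
proof -
  define l m where "l = 1 + r" and "m = 1 / (1 + r)"
  have lm: "1 \<le> l" "0 < m" "m < 1" "l * m = 1" using assms by (auto simp: l_def m_def)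
  have "1 - m = r / (1 + r)" using assms by (simp add: m_def field_simps)
  also have "\<dots> \<le> r" using assms by (simp add: field_simps)
  finally have "1 - m \<le> r" .
  obtain n where n: "m ^ n < r" using real_arch_pow_inv[OF assms lm(3)] by blast
  \<comment> \<open>A successor, because \<open>factorable_funpow\<close> covers positive numbers of
    iterations.\<close>
  define N where "N = Suc n"
  have "m ^ N \<le> m ^ n" using lm by (simp add: N_def mult_left_le_one_le)
  \<comment> \<open>The image of 1/2 under \<open>N\<close> pulls, sent back to 1/2 by
    \<open>N\<close> pushes.\<close>
  define d where "d = m ^ N / 2"
  have "m ^ N \<le> 1" using lm by (simp add: power_le_one)
  moreover have "0 < m ^ N" using lm by simp
  ultimately have d: "0 < d" "d \<le> 1 / 2" "d \<le> r"
    using n \<open>m ^ N \<le> m ^ n\<close> by (auto simp: d_def)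
  have ld: "l ^ N * d = 1 / 2"
    using lm by (simp add: d_def flip: power_mult_distrib)
  define Z where "Z = (push l ^^ N) \<circ> (small_zigzag d \<circ> (pull m ^^ N))"
  have np: "near_id r (pull m)" using near_id_pull[of m] lm \<open>1 - m \<le> r\<close> near_id_mono by auto
  have nq: "near_id r (push l)" using near_id_push[of l] lm by (simp add: l_def)
  have ns: "near_id r (small_zigzag d)" using near_id_small_zigzag[of d] d near_id_mono by auto
  have "factorable r Z"
    unfolding Z_def N_def
    by (intro factorable_comp factorable_funpow factorable_near_id np nq ns)
  moreover have "Z u = zigzag (2 * u) / 2" if "u \<in> {0..1/2}" for u
  proof -
    have "m ^ N * u \<le> m ^ N * (1 / 2)" using that lm by (intro mult_left_mono) auto
    then have "m ^ N * u \<le> d" by (simp add: d_def)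
    then have "small_zigzag d ((pull m ^^ N) u) = d * zigzag (2 * u)"
      using that lm d \<open>0 < m ^ N\<close> by (simp add: funpow_pull small_zigzag_simps) (simp add: d_def mult.commute)
    moreover have "l ^ N * (d * zigzag (2 * u)) = zigzag (2 * u) / 2"
      using ld by (simp flip: mult.assoc)
    moreover have "zigzag (2 * u) / 2 \<le> 1 / 2" "0 \<le> d * zigzag (2 * u)"
      using d zigzag_mem[of "2 * u"] by simp_all
    ultimately show ?thesis
      using funpow_push[OF lm(1), of "d * zigzag (2 * u)" N] by (simp only: Z_def comp_apply)
  qed
  \<comment> \<open>The pulls do not shrink the gap; the small zigzag and each of the
    \<open>N\<close> pushes at most halve it.\<close>
  moreover have "(1/2) ^ Suc N * (1 - u) \<le> 1 - Z u" if u: "u \<in> {0..1}" for u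
  proof -
    have mem: "pull m u \<in> {0..1}" "push l u \<in> {0..1}" "small_zigzag d u \<in> {0..1}"
      if "u \<in> {0..1}" for u
      using np nq ns that unit_map_mem unfolding near_id_def by auto
    define v where "v = (pull m ^^ N) u"
    have v: "v \<in> {0..1}" "1 - u \<le> 1 - v"
      using funpow_gap[of "pull m" 1 u N] mem pull_gap[of m] lm u by (auto simp: v_def)
    have w: "1 / 2 * (1 - v) \<le> 1 - small_zigzag d v"
      using small_zigzag_gap d v by blast
    have "(1/2) ^ Suc N * (1 - u) = (1/2) ^ N * (1 / 2 * (1 - u))" by simp
    also have "\<dots> \<le> (1/2) ^ N * (1 - small_zigzag d v)"
      using v w by (intro mult_left_mono) auto
    also have "\<dots> \<le> 1 - (push l ^^ N) (small_zigzag d v)"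
      using funpow_gap[of "push l" "1/2" "small_zigzag d v" N] mem push_gap v by auto
    finally show ?thesis by (simp add: Z_def v_def)
  qed
  moreover have "(0::real) < (1/2) ^ Suc N" "(1/2::real) ^ Suc N \<le> 1"
    by (auto intro: power_le_one simp del: power_Suc)
  ultimately show ?thesis by blast
qed

text \<open>Each step multiplies the gap to 1 by \<open>l > 1\<close> until it saturates at 1, that
  is, at the point 0. However close \<open>l\<close> is to 1, enough steps exceed any factor
  \<open>A\<close>.\<close>

lemma collapse_block:
  assumes "0 < r"
  shows "\<exists>K. factorable r K \<and> (\<forall>u\<in>{0..1}. min 1 (A * (1 - u)) \<le> 1 - K u)"
proof -
  define l where "l = 1 + r"
  have l: "1 < l" using assms by (simp add: l_def)
  obtain n where n: "A < l ^ n" using real_arch_pow[OF l] by blast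
  have near: "near_id r (collapse l)" using near_id_collapse[of l] l by (simp add: l_def)
  have step: "min 1 (l ^ N * (1 - u)) \<le> 1 - (collapse l ^^ N) u" if "u \<in> {0..1}" for N u
  proof (induction N)
    case (Suc N)
    have "l * min 1 (l ^ N * (1 - u)) \<le> l * (1 - (collapse l ^^ N) u)"
      using Suc l by (intro mult_left_mono) auto
    moreover have "min 1 (l ^ Suc N * (1 - u)) \<le> l * min 1 (l ^ N * (1 - u))"
      using l mult_mono[of 1 l 1 "l ^ N * (1 - u)"] by (auto simp: min_def mult_ac)
    moreover have "(collapse l ^^ Suc N) u = max 0 (1 - l * (1 - (collapse l ^^ N) u))"
      by (simp add: collapse_def[of l "(collapse l ^^ N) u"])
    ultimately show ?case by linarith
  qed simp
  have "min 1 (A * (1 - u)) \<le> 1 - (collapse l ^^ Suc n) u" if "u \<in> {0..1}" for u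
  proof -
    have "l ^ n \<le> l ^ Suc n" using l by (intro power_increasing) auto
    with n have "A \<le> l ^ Suc n" by linarith
    then have "A * (1 - u) \<le> l ^ Suc n * (1 - u)"
      using that by (intro mult_right_mono) auto
    with step[OF that, of "Suc n"] show ?thesis by linarith
  qed
  then show ?thesis using factorable_funpow[OF near] by blast
qed

section \<open>Separated sets\<close>

text \<open>\<open>sep_num\<close> is a supremum of naturals and is an upper bound only if this set
  is bounded. By uniform continuity the points of a separated set lie in different cells of a grid
  of some mesh \<open>\<delta>\<close>.\<close>

lemma separated_card_bounded:
  fixes f :: "nat \<Rightarrow> real \<Rightarrow> real"
  assumes "\<And>j. continuous_on {0..1} (nds_iter f (A j))" "0 < \<epsilon>" "0 < n"
  shows "bdd_above {card E | E. finite E \<and> E \<subseteq> {0..1} \<and> separated f A n \<epsilon> E}"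
proof -
  have "\<exists>d>0. \<forall>x\<in>{0..1}. \<forall>y\<in>{0..1}. dist x y < d \<longrightarrow>
      dist (nds_iter f (A j) x) (nds_iter f (A j) y) < \<epsilon>" for j
    using compact_uniformly_continuous[OF assms(1) compact_Icc] assms(2)
    unfolding uniformly_continuous_on_def by (metis dist_commute)
  then obtain d where d: "\<And>j. d j > 0" "\<And>j x y. x \<in> {0..1} \<Longrightarrow> y \<in> {0..1} \<Longrightarrow> dist x y < d j \<Longrightarrow>
      dist (nds_iter f (A j) x) (nds_iter f (A j) y) < \<epsilon>" by metis
  \<comment> \<open>A common modulus of uniform continuity for the first \<open>n\<close> sampled
    iterates.\<close>
  define \<delta> where "\<delta> = Min (d ` {..<n})"
  have "\<delta> \<in> d ` {..<n}"
    using assms(3) unfolding \<delta>_def by (intro Min_in) auto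
  then have \<delta>: "0 < \<delta>" "\<And>j. j < n \<Longrightarrow> \<delta> \<le> d j" using d(1) by (auto simp: \<delta>_def)
  have "card E \<le> card {0..\<lfloor>1 / \<delta>\<rfloor>}" if E: "E \<subseteq> {0..1}" "separated f A n \<epsilon> E" for E
  proof (rule card_inj_on_le)
    show "(\<lambda>x. \<lfloor>x / \<delta>\<rfloor>) ` E \<subseteq> {0..\<lfloor>1 / \<delta>\<rfloor>}"
      using E(1) \<delta>(1) by (force intro!: floor_mono divide_right_mono)
    show "inj_on (\<lambda>x. \<lfloor>x / \<delta>\<rfloor>) E"
    proof (rule inj_onI, rule ccontr)
      fix x y assume xy: "x \<in> E" "y \<in> E" "\<lfloor>x / \<delta>\<rfloor> = \<lfloor>y / \<delta>\<rfloor>" "x \<noteq> y"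
      then have "\<bar>x / \<delta> - y / \<delta>\<bar> < 1" by linarith
      then have "\<bar>x - y\<bar> / \<delta> < 1" using \<delta>(1) by (simp flip: diff_divide_distrib)
      then have "dist x y < \<delta>" using \<delta>(1) by (simp add: dist_real_def)
      then have "dist (nds_iter f (A j) x) (nds_iter f (A j) y) < \<epsilon>" if "j < n" for j
        using \<delta>(2)[OF that] d(2) xy E(1) by (meson less_le_trans subsetD)
      then have "seq_dist f A n x y < \<epsilon>"
        using assms(3) unfolding seq_dist_def by (subst Max_less_iff) auto
      with xy E(2) show False unfolding separated_def by force
    qed
  qed simp
  then show ?thesis by (intro bdd_aboveI) blast
qed

lemma sep_num_ge_card:
  fixes f :: "nat \<Rightarrow> real \<Rightarrow> real"
  assumes "\<And>j. continuous_on {0..1} (nds_iter f (A j))" "0 < \<epsilon>" "0 < n"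
    "finite E" "E \<subseteq> {0..1}" "separated f A n \<epsilon> E"
  shows "card E \<le> sep_num {0..1} f A n \<epsilon>"
  unfolding sep_num_def
  by (rule cSup_upper[OF _ separated_card_bounded]) (use assms in auto)

text \<open>The growth rate is monotone in the scale, so its limit at 0 exists and equals the
  supremum. Hence a bound at one scale, for infinitely many \<open>n\<close>, suffices.\<close>

lemma seq_entropy_ge:
  fixes f :: "nat \<Rightarrow> real \<Rightarrow> real"
  assumes "\<And>j. continuous_on {0..1} (nds_iter f (A j))" "0 < \<epsilon>"
    "\<exists>\<^sub>F n in sequentially. h \<le> ln (real (sep_num {0..1} f A n \<epsilon>)) / real n"
  shows "ereal h \<le> seq_entropy {0..1} f A"
proof -
  define \<phi> where "\<phi> e = limsup (\<lambda>n. ereal (ln (real (sep_num {0..1} f A n e)) / real n))" for e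
  have mono: "\<phi> b \<le> \<phi> a" if ab: "0 < a" "a \<le> b" for a b
    unfolding \<phi>_def
  \<comment> \<open>At \<open>n = 0\<close> the distance \<open>seq_dist\<close> would be a maximum
    over the empty set.\<close>
  proof (rule Limsup_mono, rule eventually_mono[OF eventually_gt_at_top[of 0]])
    fix n :: nat assume n: "0 < n"
    have sub: "separated f A n b E \<Longrightarrow> separated f A n a E" for E
      using ab unfolding separated_def by force
    have "sep_num {0..1} f A n b \<le> sep_num {0..1} f A n a"
      unfolding sep_num_def
    proof (rule cSup_subset_mono[OF _ separated_card_bounded])
      show "{card E |E. finite E \<and> E \<subseteq> {0..1} \<and> separated f A n b E} \<noteq> {}"
        by (auto simp: separated_def intro!: exI[of _ "{}"])
    qed (use assms n ab sub in auto)
    \<comment> \<open>A singleton is always separated; this keeps the argument of \<open>ln\<close>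
      positive.\<close>
    moreover have "1 \<le> sep_num {0..1} f A n b"
      using sep_num_ge_card[OF assms(1), of b n "{0}"] n ab by (simp add: separated_def)
    ultimately show "ereal (ln (real (sep_num {0..1} f A n b)) / real n)
        \<le> ereal (ln (real (sep_num {0..1} f A n a)) / real n)"
      by (auto intro!: divide_right_mono ln_mono)
  qed
  have "(\<phi> \<longlongrightarrow> (SUP e\<in>{0<..}. \<phi> e)) (at_right 0)"
  proof (rule order_tendstoI)
    fix a assume "a < (SUP e\<in>{0<..}. \<phi> e)"
    then obtain b where b: "0 < b" "a < \<phi> b" by (auto simp: less_SUP_iff)
    then have "\<forall>\<^sub>F e in at_right 0. e \<in> {0<..<b}" by (intro eventually_at_right_real)
    then show "\<forall>\<^sub>F e in at_right 0. a < \<phi> e"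
      by (rule eventually_mono) (use mono b in \<open>auto intro: less_le_trans\<close>)
  next
    fix a assume a: "(SUP e\<in>{0<..}. \<phi> e) < a"
    have "\<forall>\<^sub>F e in at_right (0::real). e \<in> {0<..<1}" by (intro eventually_at_right_real) simp
    then show "\<forall>\<^sub>F e in at_right 0. \<phi> e < a"
      by (rule eventually_mono) (use a in \<open>auto intro: le_less_trans[OF SUP_upper]\<close>)
  qed
  then have "seq_entropy {0..1} f A = (SUP e\<in>{0<..}. \<phi> e)"
    unfolding seq_entropy_def \<phi>_def[symmetric]
    by (intro tendsto_Lim) auto
  moreover have "\<phi> \<epsilon> \<le> (SUP e\<in>{0<..}. \<phi> e)"
    using assms(2) by (intro SUP_upper) auto
  moreover have "ereal h \<le> \<phi> \<epsilon>"
  proof (rule ccontr)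
    assume "\<not> ereal h \<le> \<phi> \<epsilon>"
    then have "\<forall>\<^sub>F n in sequentially. ereal (ln (real (sep_num {0..1} f A n \<epsilon>)) / real n) < ereal h"
      unfolding \<phi>_def not_le by (rule Limsup_lessD)
    then have "\<forall>\<^sub>F n in sequentially. \<not> h \<le> ln (real (sep_num {0..1} f A n \<epsilon>)) / real n"
      by (rule eventually_mono) simp
    with assms(3) show False unfolding frequently_def by simp
  qed
  ultimately show ?thesis by simp
qed


section \<open>Absorption excludes Li-Yorke pairs\<close>

text \<open>Every orbit is eventually constant, so the distance of two orbits converges and its
  limsup and liminf coincide. A scrambled set therefore has at most one point.\<close>

lemma not_LY_chaotic_if_absorbed:
  fixes f :: "nat \<Rightarrow> real \<Rightarrow> real"
  assumes "\<And>n. nds_iter f n 1 = 1"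
    "\<And>x. x \<in> {0..<1} \<Longrightarrow> \<forall>\<^sub>F n in sequentially. nds_iter f n x = 0"
  shows "\<not> LY_chaotic {0..1} f"
proof -
  have eq: "x = y" if S: "S \<subseteq> {0..1}" "LY_scrambled f S" "x \<in> S" "y \<in> S" for S x y
  proof (rule ccontr)
    assume "x \<noteq> y"
    then have LY: "LY_pair f x y" using S unfolding LY_scrambled_def by blast
    have ev: "\<forall>\<^sub>F n in sequentially. nds_iter f n z = (if z = 1 then 1 else 0)" if "z \<in> S" for z
      using assms S(1) that by (cases "z = 1") auto
    \<comment> \<open>Of two distinct points at most one is 1; then the orbits end at distance 1,
      otherwise both end at 0.\<close>
    define c :: real where "c = (if x = 1 \<or> y = 1 then 1 else 0)"
    have "\<forall>\<^sub>F n in sequentially. ereal (dist (nds_iter f n x) (nds_iter f n y)) = ereal c"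
      using ev[OF S(3)] ev[OF S(4)]
      by eventually_elim (use \<open>x \<noteq> y\<close> in \<open>auto simp: c_def\<close>)
    then have "(\<lambda>n. ereal (dist (nds_iter f n x) (nds_iter f n y))) \<longlonglongrightarrow> ereal c"
      by (rule tendsto_eventually)
    then have "limsup (\<lambda>n. ereal (dist (nds_iter f n x) (nds_iter f n y))) = ereal c"
      "liminf (\<lambda>n. ereal (dist (nds_iter f n x) (nds_iter f n y))) = ereal c"
      using lim_imp_Limsup lim_imp_Liminf sequentially_bot by blast+
    with LY show False unfolding LY_pair_def by auto
  qed
  have "countable S" if "S \<subseteq> {0..1}" "LY_scrambled f S" for S
  proof (cases "S = {}")
    case False
    then obtain x where "x \<in> S" by blast
    then have "S \<subseteq> {x}" using eq[OF that] by blast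
    then show ?thesis using countable_subset by blast
  qed simp
  then show ?thesis unfolding LY_chaotic_def by blast
qed

section \<open>The accelerated system\<close>

text \<open>Up to the scaling \<open>u \<mapsto> u / 2\<close>, orbits staying in [0, 1/2] are
  zigzag orbits. One starting point per word of length \<open>m\<close> over nine letters is found;
  \<open>m\<close> observation times need only \<open>m - 1\<close> zigzags.\<close>

lemma zigzag_iterates_separated:
  fixes F :: "nat \<Rightarrow> real \<Rightarrow> real" and m :: nat
  assumes "F 0 ` {0..1} = {0..1}"
    and "\<And>j x. Suc j < m \<Longrightarrow> x \<in> {0..1} \<Longrightarrow> F j x \<in> {0..1/2} \<Longrightarrow> F (Suc j) x = zigzag (2 * F j x) / 2"
  shows "\<exists>E\<subseteq>{0..1}. finite E \<and> card E = 9 ^ m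
    \<and> (\<forall>x\<in>E. \<forall>y\<in>E. x \<noteq> y \<longrightarrow> (\<exists>j<m. dist (F j x) (F j y) > 1 / 40))"
proof -
  define W where "W = {w. set w \<subseteq> {..<9::nat} \<and> length w = m}"
  have "\<exists>x\<in>{0..1}. \<forall>j<m. 2 * F j x \<in> {2 * real (w ! j) / 17..(2 * real (w ! j) + 1) / 17}"
    if w: "w \<in> W" for w
  proof -
    obtain u where u: "u \<in> {0..1}" "\<And>j. j < m \<Longrightarrow>
        (zigzag ^^ j) u \<in> {2 * real (w ! j) / 17..(2 * real (w ! j) + 1) / 17}"
      using zigzag_itinerary[of w] w unfolding W_def by auto
    \<comment> \<open>Surjectivity of everything that happened before the run allows any starting
      point.\<close>
    have "u / 2 \<in> F 0 ` {0..1}" using u(1) assms(1) by auto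
    then obtain x where x: "x \<in> {0..1}" "F 0 x = u / 2" by auto
    have mem: "(zigzag ^^ j) u \<in> {0..1}" for j
      by (cases j) (use u(1) zigzag_mem in auto)
    have "F j x = (zigzag ^^ j) u / 2" if "j < m" for j
      using that
    proof (induction j)
      case (Suc j)
      then have "2 * F j x = (zigzag ^^ j) u" by simp
      then show ?case using assms(2)[OF Suc.prems x(1)] mem[of j] by simp
    qed (use x in simp)
    then have "2 * F j x = (zigzag ^^ j) u" if "j < m" for j
      using that by (metis field_sum_of_halves mult_2)
    with u(2) x(1) show ?thesis by (intro bexI[of _ x]) simp_all
  qed
  then obtain p where p: "\<And>w. w \<in> W \<Longrightarrow> p w \<in> {0..1}"
    "\<And>w j. w \<in> W \<Longrightarrow> j < m \<Longrightarrow>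
      2 * F j (p w) \<in> {2 * real (w ! j) / 17..(2 * real (w ! j) + 1) / 17}" by metis
  have sep: "\<exists>j<m. dist (F j (p v)) (F j (p w)) > 1 / 40" if vw: "v \<in> W" "w \<in> W" "v \<noteq> w" for v w
  proof -
    obtain j where j: "j < m" "v ! j \<noteq> w ! j"
      using vw nth_equalityI[of v w] unfolding W_def by auto
    then consider "real (v ! j) + 1 \<le> real (w ! j)" | "real (w ! j) + 1 \<le> real (v ! j)"
      by linarith
    \<comment> \<open>Different laps are 1/17 apart, hence 1/34 after halving; 1/40 leaves room for
      a strict inequality.\<close>
    then have "dist (F j (p v)) (F j (p w)) \<ge> 1 / 34"
      using p(2)[OF vw(1) j(1)] p(2)[OF vw(2) j(1)]
      by cases (auto simp: dist_real_def field_simps)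
    with j(1) show ?thesis by (intro exI[of _ j]) auto
  qed
  have "inj_on p W"
  proof (rule inj_onI, rule ccontr)
    fix v w assume "v \<in> W" "w \<in> W" "p v = p w" "v \<noteq> w"
    with sep[of v w] show False by auto
  qed
  then have "card (p ` W) = 9 ^ m"
    unfolding W_def by (simp add: card_image card_lists_length_eq)
  moreover have "finite W" unfolding W_def by (rule finite_lists_length_eq) simp
  moreover have "\<forall>x\<in>p ` W. \<forall>y\<in>p ` W. x \<noteq> y \<longrightarrow> (\<exists>j<m. dist (F j x) (F j y) > 1 / 40)"
    using sep by blast
  moreover have "p ` W \<subseteq> {0..1}" using p(1) by blast
  ultimately show ?thesis by blast
qed

text \<open>Time is counted in moves here. Move \<open>n + 1\<close> is built from factors within
  \<open>1 / (n + 1)\<close> of the identity.\<close>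

lemma accelerated_system:
  obtains G :: "nat \<Rightarrow> real \<Rightarrow> real"
  where "\<And>n. factorable (1 / real (Suc n)) (G (Suc n))"
    and "\<And>n u. (\<nexists>k. n = 2 ^ k) \<Longrightarrow> u \<in> {0..1/2} \<Longrightarrow> G n u = zigzag (2 * u) / 2"
    and "\<And>x. x \<in> {0..<1} \<Longrightarrow> \<exists>n. nds_iter G (Suc n) x = 0"
proof -
  have "\<exists>Z c. factorable (1 / real (Suc n)) Z \<and> (\<forall>u\<in>{0..1/2}. Z u = zigzag (2 * u) / 2)
      \<and> 0 < c \<and> c \<le> 1 \<and> (\<forall>u\<in>{0..1}. c * (1 - u) \<le> 1 - Z u)" for n
    by (rule zigzag_block) simp
  then obtain Z c where Z: "\<And>n. factorable (1 / real (Suc n)) (Z n)"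
    "\<And>n u. u \<in> {0..1/2} \<Longrightarrow> Z n u = zigzag (2 * u) / 2"
    "\<And>n. 0 < c n" "\<And>n. c n \<le> 1" "\<And>n u. u \<in> {0..1} \<Longrightarrow> c n * (1 - u) \<le> 1 - Z n u"
    by metis
  \<comment> \<open>The fraction of the gap to 1 that is sure to survive the first \<open>n\<close>
    moves.\<close>
  define D where "D n = (\<Prod>i<n. c i)" for n
  have D: "0 < D n" "D n \<le> 1" for n
    using Z(3,4) less_imp_le[OF Z(3)] by (auto simp: D_def intro!: prod_pos prod_le_1)
  \<comment> \<open>Dividing by \<open>D n\<close> undoes all earlier losses; the growing factor
    \<open>Suc n\<close> then catches every point below 1 in the end.\<close>
  have "\<exists>K. factorable (1 / real (Suc n)) K
      \<and> (\<forall>u\<in>{0..1}. min 1 (real (Suc n) / D n * (1 - u)) \<le> 1 - K u)" for n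
    by (rule collapse_block) simp
  then obtain K where K: "\<And>n. factorable (1 / real (Suc n)) (K n)"
    "\<And>n u. u \<in> {0..1} \<Longrightarrow> min 1 (real (Suc n) / D n * (1 - u)) \<le> 1 - K n u"
    by metis
  define G where "G n = (if \<exists>k. n = 2 ^ k then K (n - 1) else Z (n - 1))" for n :: nat
  have fac: "factorable (1 / real (Suc n)) (G (Suc n))" for n
    using Z(1) K(1) by (simp add: G_def)
  have unit: "unit_map (nds_iter G n)" for n
    using fac unit_map_factorable by (intro unit_map_nds_iter) blast
  have gap: "D n * (1 - x) \<le> 1 - nds_iter G n x" if x: "x \<in> {0..1}" for n x
  proof (induction n)
    case (Suc n)
    define v where "v = nds_iter G n x"
    have v: "v \<in> {0..1}" using unit_map_mem[OF unit x] by (simp add: v_def)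
    \<comment> \<open>The bound designed for zigzags also holds for collapses: their strength is at
      least 1, so they never shrink the gap.\<close>
    have "c n * (1 - v) \<le> 1 - G (Suc n) v"
    proof (cases "\<exists>k. Suc n = 2 ^ k")
      case True
      have "D n \<le> real (Suc n)" using D(2)[of n] by simp
      then have "1 \<le> real (Suc n) / D n" using D(1)[of n] by simp
      then have "1 * (1 - v) \<le> real (Suc n) / D n * (1 - v)"
        using v by (intro mult_right_mono) auto
      then have "1 - v \<le> 1 - K n v" using K(2)[OF v, of n] v by auto
      moreover have "c n * (1 - v) \<le> 1 - v"
        using Z(3)[of n] Z(4)[of n] v by (intro mult_left_le_one_le) auto
      ultimately show ?thesis using True by (simp add: G_def)
    qed (use Z(5)[OF v] in \<open>simp add: G_def\<close>)
    moreover have "c n * (D n * (1 - x)) \<le> c n * (1 - v)"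
      using Suc Z(3)[of n] by (intro mult_left_mono) (auto simp: v_def)
    ultimately show ?case by (simp add: D_def v_def mult_ac)
  qed (simp add: D_def)
  show ?thesis
  proof (rule that[of G])
    show "G n u = zigzag (2 * u) / 2" if "\<nexists>k. n = 2 ^ k" "u \<in> {0..1/2}" for n u
      using that Z(2) by (simp add: G_def)
    show "\<exists>n. nds_iter G (Suc n) x = 0" if x: "x \<in> {0..<1}" for x
    proof -
      \<comment> \<open>At the collapse numbered \<open>2 ^ k\<close> the guaranteed gap, multiplied
        by its strength, is at least 1, which forces the image to be 0.\<close>
      obtain k where k: "1 / (1 - x) < 2 ^ k" using real_arch_pow[of 2 "1 / (1 - x)"] by auto
      define n where "n = 2 ^ k - (1::nat)"
      have n: "Suc n = 2 ^ k" by (simp add: n_def)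
      define v where "v = nds_iter G n x"
      have v: "v \<in> {0..1}" using unit_map_mem[OF unit, of x n] x by (simp add: v_def)
      have "1 \<le> real (Suc n) * (1 - x)"
        using k x unfolding n by (simp add: field_simps)
      also have "\<dots> = real (Suc n) / D n * (D n * (1 - x))" using D(1)[of n] by simp
      also have "\<dots> \<le> real (Suc n) / D n * (1 - v)"
        using gap[of x n] x D(1)[of n] unfolding v_def by (intro mult_left_mono) auto
      finally have "K n v \<le> 0" using K(2)[OF v, of n] by linarith
      moreover have "0 \<le> K n v" using unit_map_mem[OF unit_map_factorable[OF K(1)] v] by simp
      moreover have "nds_iter G (Suc n) x = K n v"
      proof -
        have "G (Suc n) = K n" using n unfolding G_def by (metis diff_Suc_1)
        then show ?thesis by (simp add: v_def)
      qed
      ultimately show ?thesis by (intro exI[of _ n]) linarith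
    qed
  qed (rule fac)
qed

section \<open>Absorption and entropy of the flattened sequence\<close>

theorem mainTheorem1:
  shows "\<exists>(f :: nat \<Rightarrow> real \<Rightarrow> real) (g :: real \<Rightarrow> real).
    (\<forall>n\<ge>1. continuous_on {0..1} (f n) \<and> f n ` {0..1} = {0..1})
    \<and> continuous_on {0..1} g \<and> g ` {0..1} \<subseteq> {0..1}
    \<and> uniform_limit {0..1} (\<lambda>n. f (Suc n)) g sequentially
    \<and> (\<exists>S :: nat \<Rightarrow> nat. strict_mono S \<and> 0 < S 0
          \<and> seq_entropy {0..1} f S \<ge> ereal (ln 3))
    \<and> \<not> LY_chaotic {0..1} f"
proof -
  obtain G :: "nat \<Rightarrow> real \<Rightarrow> real"
    where G: "\<And>n. factorable (1 / real (Suc n)) (G (Suc n))"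
      "\<And>n u. (\<nexists>k. n = 2 ^ k) \<Longrightarrow> u \<in> {0..1/2} \<Longrightarrow> G n u = zigzag (2 * u) / 2"
      "\<And>x. x \<in> {0..<1} \<Longrightarrow> \<exists>n. nds_iter G (Suc n) x = 0"
    using accelerated_system by blast
  have "(\<lambda>n. 1 / real (Suc n)) \<longlonglongrightarrow> 0"
    using LIMSEQ_inverse_real_of_nat by (simp add: inverse_eq_divide)
  then obtain f S where f: "\<And>n. unit_map (f (Suc n))"
    "uniform_limit {0..1} (\<lambda>n. f (Suc n)) (\<lambda>x. x) sequentially"
    "strict_mono S" "0 < S 0" "\<And>n. nds_iter f (S n) = nds_iter G (Suc n)"
    using flatten_factorable[of "\<lambda>n. 1 / real (Suc n)" G, OF G(1)] by blast
  have unit_f: "unit_map (nds_iter f n)" for n using f(1) by (rule unit_map_nds_iter)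
  have unit_G: "unit_map (nds_iter G n)" for n
    using G(1) unit_map_factorable by (intro unit_map_nds_iter) blast
  have "\<not> LY_chaotic {0..1} f"
  proof (rule not_LY_chaotic_if_absorbed)
    show "nds_iter f n 1 = 1" for n using unit_f[of n] by (simp add: unit_map_def)
    show "\<forall>\<^sub>F n in sequentially. nds_iter f n x = 0" if x: "x \<in> {0..<1}" for x
    proof -
      obtain n0 where "nds_iter f (S n0) x = 0" using G(3)[OF x] f(5) by auto
      \<comment> \<open>Every map of the sequence fixes 0.\<close>
      then have "nds_iter f (S n0 + i) x = 0" for i
        by (induction i) (use f(1) in \<open>auto simp: unit_map_def\<close>)
      then have "nds_iter f n x = 0" if "n \<ge> S n0" for n
        using that by (metis le_add_diff_inverse)
      then show ?thesis unfolding eventually_sequentially by blast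
    qed
  qed
  moreover have "ereal (ln 3) \<le> seq_entropy {0..1} f S"
  proof (rule seq_entropy_ge[of _ _ "1 / 40"])
    show cont: "continuous_on {0..1} (nds_iter f (S j))" for j
      using unit_f by (simp add: unit_map_def)
    show "\<exists>\<^sub>F n in sequentially. ln 3 \<le> ln (real (sep_num {0..1} f S n (1 / 40))) / real n"
      unfolding frequently_sequentially
    proof
      fix k :: nat
      \<comment> \<open>The first \<open>n\<close> sampling times are the ends of moves 1 to
        \<open>2 * m - 1\<close>, just before the next collapse. Moves \<open>m + 1\<close> to
        \<open>2 * m - 1\<close> lie strictly between consecutive powers of 2, so all are
        zigzags.\<close>
      define m n :: nat where "m = 2 ^ k" and "n = 2 * m - 1"
      have m: "k < m" "0 < m" by (simp_all add: m_def)
      have n: "k \<le> n" "0 < n" "n \<le> 2 * m" using m by (auto simp: n_def)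
      have npow: "\<nexists>i. Suc (m + j) = 2 ^ i" if "Suc j < m" for j
      proof
        assume "\<exists>i. Suc (m + j) = 2 ^ i"
        then obtain i where i: "Suc (m + j) = 2 ^ i" by blast
        have "m < 2 ^ i" "2 ^ i < 2 * m" unfolding i[symmetric] using that by simp_all
        then have "(2::nat) ^ k < 2 ^ i" "(2::nat) ^ i < 2 ^ Suc k" by (simp_all add: m_def)
        then have "k < i" "i < Suc k"
          using power_less_imp_less_exp[of "2::nat"] by (meson one_less_numeral_iff semiring_norm(76))+
        then show False by simp
      qed
      have "\<exists>E\<subseteq>{0..1}. finite E \<and> card E = 9 ^ m \<and> (\<forall>x\<in>E. \<forall>y\<in>E. x \<noteq> y \<longrightarrow>
          (\<exists>j<m. dist (nds_iter G (m + j) x) (nds_iter G (m + j) y) > 1 / 40))"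
      proof (rule zigzag_iterates_separated)
        show "nds_iter G (m + 0) ` {0..1} = {0..1}" using unit_map_surj[OF unit_G] by simp
      qed (use G(2) npow in simp)
      then obtain E where E: "E \<subseteq> {0..1}" "finite E" "card E = 9 ^ m"
        "\<And>x y. x \<in> E \<Longrightarrow> y \<in> E \<Longrightarrow> x \<noteq> y \<Longrightarrow>
          \<exists>j<m. dist (nds_iter G (m + j) x) (nds_iter G (m + j) y) > 1 / 40" by blast
      have "separated f S n (1 / 40) E"
        unfolding separated_def
      proof (intro ballI impI)
        fix x y assume "x \<in> E" "y \<in> E" "x \<noteq> y"
        then obtain j where j: "j < m" "dist (nds_iter G (m + j) x) (nds_iter G (m + j) y) > 1 / 40"
          using E(4) by blast
        \<comment> \<open>\<open>S i\<close> is the end of move \<open>i + 1\<close>.\<close>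
        define i where "i = m + j - 1"
        have i: "i < n" "Suc i = m + j" using j(1) m by (auto simp: i_def n_def)
        have "1 / 40 < dist (nds_iter f (S i) x) (nds_iter f (S i) y)"
          using j(2) unfolding f(5) i(2) .
        also have "\<dots> \<le> seq_dist f S n x y"
          unfolding seq_dist_def using i(1) by (intro Max_ge) auto
        finally show "1 / 40 < seq_dist f S n x y" .
      qed
      then have le: "9 ^ m \<le> sep_num {0..1} f S n (1 / 40)"
        using sep_num_ge_card[OF cont, of "1 / 40" n E] E n by simp
      \<comment> \<open>The count \<open>9 ^ m = 3 ^ (2 * m)\<close> belongs to fewer than
        \<open>2 * m\<close> sampling times: the first half of them, spent before the run, is paid
        for by nine laps instead of three.\<close>
      have "ln 3 * real n \<le> ln 3 * real (2 * m)" using n(3) by (intro mult_left_mono) auto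
      also have "\<dots> = ln (3 ^ (2 * m))" by (simp add: ln_realpow)
      also have "\<dots> = ln (real (9 ^ m))" by (simp add: power_mult)
      also have "\<dots> \<le> ln (real (sep_num {0..1} f S n (1 / 40)))"
        using le by (intro ln_mono) (simp_all only: of_nat_le_iff, simp_all)
      finally have "ln 3 \<le> ln (real (sep_num {0..1} f S n (1 / 40))) / real n"
        using n(2) by (simp add: pos_le_divide_eq)
      with n(1) show "\<exists>n\<ge>k. ln 3 \<le> ln (real (sep_num {0..1} f S n (1 / 40))) / real n" by blast
    qed
  qed simp
  moreover have "\<forall>n\<ge>1. continuous_on {0..1} (f n) \<and> f n ` {0..1} = {0..1}"
  proof (intro allI impI)
    fix n :: nat assume "1 \<le> n"
    then have "unit_map (f n)" using f(1)[of "n - 1"] by simp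
    then show "continuous_on {0..1} (f n) \<and> f n ` {0..1} = {0..1}"
      using unit_map_surj by (auto simp: unit_map_def)
  qed
  ultimately show ?thesis
    using f(2-4) by (intro exI[of _ f] exI[of _ "\<lambda>x. x"]) auto
qed

end
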